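(* Let $R$ be a left Artinian ring such that $2 \in U(R)$ and $\omega(G(R)) < \infty$. Then $R$ is a finite ring.
   Context: Rings are associative, not necessarily commutative, with identity $1 \neq 0$. $U(R)$ is the set of units of $R$. The unit graph $G(R)$ is the simple graph whose vertices are the elements of $R$, where two distinct vertices $a, b$ are adjacent if and only if $a+b \in U(R)$. The clique number $\omega(G)$ of a graph $G$ is the number of vertices of a largest clique (complete subgraph) of $G$; $\omega(G)<\infty$ means that the sizes of cliques of $G$ are bounded by a natural number. *)

theory Defs
  imports Complex_Main "HOL-Library.Extended_Nat" "HOL-Library.Ramsey"
begin

text \<open>
  A ring is a type of class \<open>ring_1\<close>: associative, not necessarily commutative, with
  identity and with \<open>0 \<noteq> 1\<close>.
\<close>

text \<open>
  Two-sided invertibility: \<open>u dvd 1\<close> would only say that \<open>u\<close> has a right inverse.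
\<close>

definition ring_units :: "'a::ring_1 set"
  where "ring_units = {u. \<exists>v. u * v = 1 \<and> v * u = 1}"

text \<open>
  Closure under negation is the case \<open>r = - 1\<close> of the last conjunct.
\<close>

definition left_ideal :: "'a::ring_1 set \<Rightarrow> bool"
  where "left_ideal I \<longleftrightarrow>
    0 \<in> I \<and> (\<forall>x\<in>I. \<forall>y\<in>I. x + y \<in> I) \<and> (\<forall>r. \<forall>x\<in>I. r * x \<in> I)"

definition left_artinian :: "'a::ring_1 itself \<Rightarrow> bool"
  where "left_artinian _ \<longleftrightarrow>
    (\<forall>I :: nat \<Rightarrow> 'a set. (\<forall>n. left_ideal (I n)) \<and> (\<forall>n. I (Suc n) \<subseteq> I n)
       \<longrightarrow> (\<exists>N. \<forall>n\<ge>N. I n = I N))"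

text \<open>
  A simple graph is a pair of a vertex set and a set of two-element edges.
\<close>

type_synonym 'a sgraph = "'a set \<times> 'a set set"

text \<open>
  \<open>clique C E\<close> says that any two distinct elements of \<open>C\<close> are joined by an edge in \<open>E\<close>.
  The supremum ranges over the finite cliques only, since \<open>card\<close> of an infinite set is \<open>0\<close>;
  subsets of cliques are cliques, so a graph with an infinite clique gets the value \<open>\<infinity>\<close>.
\<close>

definition clique_number :: "'a sgraph \<Rightarrow> enat"
  where "clique_number G =
    Sup {enat (card C) | C. C \<subseteq> fst G \<and> finite C \<and> clique C (snd G)}"

definition unit_graph :: "'a::ring_1 sgraph"
  where "unit_graph = (UNIV, {{a, b} | a b. a \<noteq> b \<and> a + b \<in> ring_units})"

end

theory Submission
  imports Defs
begin

text \<open>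
  Suppose \<open>R\<close> is infinite. If \<open>f\<close> and \<open>g\<close> are orthogonal idempotents, then \<open>1 + fRg\<close> is a clique,
  because \<open>fRg\<close> squares to zero and \<open>2\<close> is a unit; hence \<open>fRg\<close> is finite, and if \<open>(f + g)R(f + g)\<close>
  is infinite, so is \<open>fRf\<close> or \<open>gRg\<close>. An idempotent \<open>e\<close> with \<open>eRe\<close> infinite and \<open>Re\<close>
  minimal is therefore primitive. The descending chain condition makes every element of \<open>eRe\<close>
  nilpotent or a unit of \<open>eRe\<close>, so the non-units \<open>N\<close> of \<open>eRe\<close> are closed under addition. As
  \<open>1 + N\<close> is a clique, \<open>N\<close> is finite, and then arbitrarily large sets of elements of \<open>eRe\<close>
  whose pairwise sums avoid \<open>N\<close> are chosen greedily; translating by \<open>1 - e\<close> turns them into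
  cliques of \<open>R\<close>.
\<close>

section \<open>Cliques in a unit graph of finite clique number\<close>

lemma bounded_cliques_if_clique_number_finite:
  assumes "clique_number (unit_graph :: 'a::ring_1 sgraph) < \<infinity>"
  obtains k where "\<And>C :: 'a set. finite C \<Longrightarrow>
    (\<And>a b. a \<in> C \<Longrightarrow> b \<in> C \<Longrightarrow> a \<noteq> b \<Longrightarrow> a + b \<in> ring_units) \<Longrightarrow> card C \<le> k"
proof -
  obtain k where k: "clique_number (unit_graph :: 'a sgraph) = enat k"
    using assms by (metis enat_ord_simps(4) not_enat_eq)
  show thesis
  proof (rule that[of k])
    fix C :: "'a set"
    assume "finite C" and C: "\<And>a b. a \<in> C \<Longrightarrow> b \<in> C \<Longrightarrow> a \<noteq> b \<Longrightarrow> a + b \<in> ring_units"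
    have "clique C (snd (unit_graph :: 'a sgraph))"
      unfolding clique_def unit_graph_def using C by auto
    with \<open>finite C\<close> have "enat (card C) \<le> clique_number (unit_graph :: 'a sgraph)"
      unfolding clique_number_def by (intro Sup_upper) (auto simp: unit_graph_def)
    then show "card C \<le> k" using k by simp
  qed
qed

text \<open>Every finite subset of \<open>X\<close> is a clique, so an infinite \<open>X\<close>
  would exceed any bound.\<close>

lemma finite_if_pairwise_unit_sums:
  assumes "clique_number (unit_graph :: 'a::ring_1 sgraph) < \<infinity>"
    and X: "\<And>a b :: 'a. a \<in> X \<Longrightarrow> b \<in> X \<Longrightarrow> a + b \<in> ring_units"
  shows "finite X"
proof (rule ccontr)
  assume "infinite X"
  obtain k where k: "\<And>C :: 'a set. finite C \<Longrightarrow>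
    (\<And>a b. a \<in> C \<Longrightarrow> b \<in> C \<Longrightarrow> a \<noteq> b \<Longrightarrow> a + b \<in> ring_units) \<Longrightarrow> card C \<le> k"
    using bounded_cliques_if_clique_number_finite[OF assms(1)] by blast
  obtain C where "C \<subseteq> X" "finite C" "card C = Suc k"
    using infinite_arbitrarily_large[OF \<open>infinite X\<close>] by metis
  with k[of C] X show False by (metis not_less_eq_eq order_refl subsetD)
qed

section \<open>Inverses and factorisations by geometric sums\<close>

lemma commute_inverse_two:
  assumes "(2::'a::ring_1) * h = 1" "h * 2 = 1"
  shows "h * x = x * h"
proof -
  have "h * x = h * (x * 2) * h" using assms by (simp add: mult.assoc)
  also have "\<dots> = h * (2 * x) * h" by (simp add: mult_2 mult_2_right)
  also have "\<dots> = x * h" using assms by (simp flip: mult.assoc)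
  finally show ?thesis .
qed

text \<open>With \<open>h\<close> the inverse of 2, the geometric series for the inverse stops at
  \<open>h - h * (h * c)\<close>, since \<open>c\<close> squares to zero.\<close>

lemma two_plus_square_zero_unit:
  assumes "(2::'a::ring_1) \<in> ring_units" "c * c = (0::'a)"
  shows "2 + c \<in> ring_units"
proof -
  obtain h :: 'a where h: "2 * h = 1" "h * 2 = 1"
    using assms(1) by (auto simp: ring_units_def)
  have com: "c * h = h * c" using commute_inverse_two[OF h] by simp
  have a: "2 * (h * z) = z" for z using h by (simp flip: mult.assoc)
  have b: "h * (h * (c * 2)) = h * c"
  proof -
    have "h * (h * (c * 2)) = h * (h * (2 * c))" by (simp add: mult_2 mult_2_right)
    also have "\<dots> = h * (h * 2 * c)" by (simp only: mult.assoc)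
    finally show ?thesis using h by simp
  qed
  have c: "c * (h * z) = h * (c * z)" "c * (c * z) = 0" for z
    using com assms(2) by (metis mult.assoc, metis mult.assoc mult_zero_left)
  have "(2 + c) * (h - h * (h * c)) = 1" "(h - h * (h * c)) * (2 + c) = 1"
    using h a b c com assms(2) by (simp_all add: algebra_simps)
  then show ?thesis by (auto simp: ring_units_def)
qed

text \<open>\<open>q\<close> is the sum of the \<open>(1 - x) ^ i\<close> for \<open>i < n\<close>.
  The second conjunct keeps what matters about a polynomial in \<open>x\<close>: it commutes with
  whatever commutes with \<open>x\<close>.\<close>

lemma one_minus_power_factor:
  "\<exists>q::'a::ring_1. 1 - (1 - x) ^ n = q * x \<and> (\<forall>y. y * x = x * y \<longrightarrow> y * q = q * y)"
proof (induction n)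
  case 0
  show ?case by (intro exI[of _ 0]) simp
next
  case (Suc n)
  then obtain q where q: "1 - (1 - x) ^ n = q * x" "\<And>y. y * x = x * y \<Longrightarrow> y * q = q * y"
    by blast
  have "1 - (1 - x) ^ Suc n = (1 - (1 - x) ^ n) + (1 - x) ^ n * x"
    by (simp add: power_Suc2 algebra_simps del: power_Suc)
  then have "1 - (1 - x) ^ Suc n = (q + (1 - x) ^ n) * x"
    using q(1) by (simp add: distrib_right)
  moreover have "y * (q + (1 - x) ^ n) = (q + (1 - x) ^ n) * y" if "y * x = x * y" for y
  proof -
    have "(1 - x) * y = y * (1 - x)" using that by (simp add: algebra_simps)
    then have "(1 - x) ^ n * y = y * (1 - x) ^ n" by (rule power_commuting_commutes)
    then show ?thesis using q(2)[OF that] by (simp add: algebra_simps)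
  qed
  ultimately show ?case by blast
qed

lemma power_mult_distrib_commuting:
  assumes "(x::'a::monoid_mult) * y = y * x"
  shows "(x * y) ^ n = x ^ n * y ^ n"
proof (induction n)
  case (Suc n)
  have "y * x ^ n = x ^ n * y" using power_commuting_commutes[of x y n] assms by simp
  then have "x * y * (x ^ n * y ^ n) = x * (x ^ n * y) * y ^ n" by (metis mult.assoc)
  then show ?case using Suc by (simp add: mult.assoc)
qed simp

section \<open>Principal left ideals and the minimum condition\<close>

definition left_multiples :: "'a::ring_1 \<Rightarrow> 'a set"
  where "left_multiples a = range (\<lambda>r. r * a)"

lemma left_ideal_left_multiples: "left_ideal (left_multiples a)"
  unfolding left_ideal_def left_multiples_def
  by (auto simp: image_iff) (metis mult_zero_left, metis distrib_right, metis mult.assoc)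

lemma self_in_left_multiples: "a \<in> left_multiples a"
  unfolding left_multiples_def by (metis mult_1_left rangeI)

lemma left_multiples_subset_iff: "left_multiples a \<subseteq> left_multiples b \<longleftrightarrow> (\<exists>r. a = r * b)"
proof
  assume "left_multiples a \<subseteq> left_multiples b"
  then show "\<exists>r. a = r * b"
    using self_in_left_multiples[of a] by (auto simp: left_multiples_def)
next
  assume "\<exists>r. a = r * b"
  then show "left_multiples a \<subseteq> left_multiples b"
    by (auto simp: left_multiples_def simp flip: mult.assoc)
qed

text \<open>The chain condition makes strict inclusion of principal left ideals well-founded;
  \<open>a\<close> generates a minimal one among the elements satisfying \<open>P\<close>.\<close>

lemma left_artinian_minimal:
  assumes "left_artinian TYPE('a::ring_1)" "P (x::'a)"
  obtains a where "P a" "\<And>b. P b \<Longrightarrow> (\<exists>r. b = r * a) \<Longrightarrow> \<exists>r. a = r * b"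
proof -
  define D where "D = {(b, a :: 'a). left_multiples b \<subset> left_multiples a}"
  have "wf D"
    unfolding wf_iff_no_infinite_down_chain
  proof
    assume "\<exists>s. \<forall>i. (s (Suc i), s i) \<in> D"
    then obtain s :: "nat \<Rightarrow> 'a" where s: "\<And>i. left_multiples (s (Suc i)) \<subset> left_multiples (s i)"
      by (auto simp: D_def)
    then obtain N where "\<forall>n\<ge>N. left_multiples (s n) = left_multiples (s N)"
      using assms(1)[unfolded left_artinian_def, rule_format, of "\<lambda>i. left_multiples (s i)"]
        left_ideal_left_multiples by blast
    then show False using s[of N] by (metis le_SucI order_refl psubset_eq)
  qed
  obtain a where "a \<in> Collect P" "\<And>b. (b, a) \<in> D \<Longrightarrow> b \<notin> Collect P"
    using wfE_min[OF \<open>wf D\<close>, of x "Collect P"] assms(2) by blast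
  then show thesis
    by (intro that[of a]) (auto simp: D_def psubset_eq simp flip: left_multiples_subset_iff)
qed

section \<open>Peirce components \<open>eRf\<close> as fixed-point sets, and idempotents in left
  ideals\<close>

definition corner :: "'a::ring_1 \<Rightarrow> 'a \<Rightarrow> 'a set"
  where "corner e f = {x. e * x = x \<and> x * f = x}"

lemma cornerD: "x \<in> corner e f \<Longrightarrow> e * x = x" "x \<in> corner e f \<Longrightarrow> x * f = x"
  by (auto simp: corner_def)

lemma corner_sandwich: "e * e = e \<Longrightarrow> f * f = f \<Longrightarrow> e * x * f \<in> corner e f"
  by (auto simp: corner_def mult.assoc) (metis mult.assoc)

lemma corner_add: "x \<in> corner e f \<Longrightarrow> y \<in> corner e f \<Longrightarrow> x + y \<in> corner e f"
  by (auto simp: corner_def algebra_simps)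

lemma corner_diff: "x \<in> corner e f \<Longrightarrow> y \<in> corner e f \<Longrightarrow> x - y \<in> corner e f"
  by (auto simp: corner_def algebra_simps)

lemma corner_mult: "x \<in> corner e f \<Longrightarrow> y \<in> corner f g \<Longrightarrow> x * y \<in> corner e g"
  by (auto simp: corner_def mult.assoc) (metis mult.assoc)

lemma corner_power: "x \<in> corner e e \<Longrightarrow> n > 0 \<Longrightarrow> x ^ n \<in> corner e e"
proof (induction n)
  case (Suc n)
  then show ?case using corner_mult[OF Suc.prems(1) Suc.IH] by (cases "n = 0") auto
qed simp

text \<open>Take a non-nilpotent \<open>a\<close> in \<open>Rx\<close> with \<open>Ra\<close>
  minimal. Then \<open>a\<close> lies in \<open>R(a * a)\<close>, which yields \<open>c\<close> in
  \<open>Ra\<close> with \<open>c * a = a\<close>. This \<open>c\<close> is idempotent up to a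
  nilpotent error, and a polynomial in \<open>c\<close> removes the error.\<close>

lemma idempotent_in_corner_left_ideal:
  assumes art: "left_artinian TYPE('a::ring_1)" and e: "(e::'a) * e = e"
    and x: "x \<in> corner e e" and nil: "\<And>n. x ^ n \<noteq> 0"
  obtains f r where "f \<in> corner e e" "f * f = f" "f \<noteq> 0" "f = r * x"
proof -
  define P where "P a \<longleftrightarrow> a \<in> corner e e \<and> (\<forall>n. a ^ n \<noteq> 0) \<and> (\<exists>r. a = r * x)" for a
  have "P x" using x nil unfolding P_def by (metis mult_1_left)
  then obtain a where "P a" and min: "\<And>b. P b \<Longrightarrow> (\<exists>r. b = r * a) \<Longrightarrow> \<exists>r. a = r * b"
    using left_artinian_minimal[OF art, of P] by blast
  then have a: "a \<in> corner e e" and a_nil: "\<And>n. a ^ n \<noteq> 0" and "\<exists>r. a = r * x"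
    by (auto simp: P_def)
  have P_multiple: "P (r * a)" if "r * a \<in> corner e e" "\<And>n. (r * a) ^ n \<noteq> 0" for r
    using that \<open>\<exists>r. a = r * x\<close> unfolding P_def by (metis mult.assoc)
  have "(a * a) ^ n \<noteq> 0" for n
    using a_nil[of "2 * n"] by (simp add: power_mult power2_eq_square)
  then obtain s where s: "a = s * (a * a)"
    using min[OF P_multiple[of a]] corner_mult[OF a a] by blast
  \<comment> \<open>Compressing \<open>s\<close> by \<open>e\<close> on both sides keeps
    \<open>c\<close> in the corner and does not change its action on \<open>a\<close>.\<close>
  define c where "c = e * s * e * a"
  have c: "c \<in> corner e e"
    unfolding c_def by (intro corner_mult[OF _ a] corner_sandwich e)
  have ca: "c * a = a"
  proof -
    have "c * a = e * (s * (e * a * a))" by (simp add: c_def mult.assoc)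
    then show ?thesis using s cornerD[OF a] by simp
  qed
  \<comment> \<open>If \<open>c\<^sup>2 - c\<close> were not nilpotent, minimality would put \<open>a\<close> into the left ideal generated
    by it; but \<open>c\<^sup>2 - c\<close> kills \<open>a\<close> from the left, so \<open>a\<^sup>2 = 0\<close>.\<close>
  have "\<exists>n. (c * (1 - c)) ^ n = 0"
  proof (rule ccontr)
    assume nonnil: "\<nexists>n. (c * (1 - c)) ^ n = 0"
    define t where "t = e * s * e - c * (e * s * e)"
    have t: "c * (1 - c) = t * a"
      by (simp add: t_def c_def algebra_simps)
    have "c * (1 - c) \<in> corner e e"
      using corner_diff[OF c corner_mult[OF c c]] by (simp add: algebra_simps)
    then have "P (t * a)" using nonnil unfolding t by (intro P_multiple) auto
    then obtain r where "a = r * (t * a)" using min by blast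
    then have "a * a = r * (c * (1 - c)) * a" using t by simp
    also have "\<dots> = r * (c * (a - c * a))" by (simp add: algebra_simps)
    finally show False using ca a_nil[of 2] by (simp add: power2_eq_square)
  qed
  then obtain m where "(c * (1 - c)) ^ m = 0" by blast
  \<comment> \<open>A positive exponent is secured, so that \<open>c ^ n\<close> lies in the corner
    and contains a factor \<open>c\<close>.\<close>
  then have "(c * (1 - c)) ^ Suc m = 0" by simp
  then obtain n where n: "(c * (1 - c)) ^ n = 0" "n > 0" by blast
  \<comment> \<open>Lifting an idempotent: \<open>f\<close> is a multiple of \<open>c ^ n\<close>
    and \<open>1 - f\<close> one of \<open>(1 - c) ^ n\<close>. All factors commute, so
    \<open>f * (1 - f)\<close> is a multiple of \<open>(c * (1 - c)) ^ n = 0\<close>.\<close>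
  define f where "f = 1 - (1 - c ^ n) ^ n"
  obtain q where q: "f = q * c ^ n" and qcom: "\<And>y. y * c ^ n = c ^ n * y \<Longrightarrow> y * q = q * y"
    using one_minus_power_factor[of "c ^ n" n] unfolding f_def by blast
  obtain p where p: "1 - c ^ n = p * (1 - c)"
    and pcom: "\<And>y. y * (1 - c) = (1 - c) * y \<Longrightarrow> y * p = p * y"
    using one_minus_power_factor[of "1 - c" n] by auto
  have "(1 - c ^ n) ^ n = p ^ n * (1 - c) ^ n"
    unfolding p by (intro power_mult_distrib_commuting sym[OF pcom]) simp
  moreover have "c ^ n * p = p * c ^ n"
  proof -
    have "c * (1 - c) = (1 - c) * c" by (simp add: algebra_simps)
    then show ?thesis by (intro power_commuting_commutes pcom)
  qed
  then have "c ^ n * p ^ n = p ^ n * c ^ n"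
    using power_commuting_commutes[of p "c ^ n" n] by simp
  moreover have "c ^ n * (1 - c) ^ n = 0"
    using n(1) power_mult_distrib_commuting[of c "1 - c" n] by (simp add: algebra_simps)
  moreover have "f * (1 - f) = q * c ^ n * (1 - c ^ n) ^ n"
    by (subst q[symmetric]) (simp add: f_def)
  ultimately have "f * (1 - f) = 0"
    by (metis mult.assoc mult_zero_right)
  then have idem: "f * f = f" by (simp add: algebra_simps)
  have cn: "c ^ n \<in> corner e e" using corner_power[OF c n(2)] .
  \<comment> \<open>\<open>q\<close> itself need not lie in the corner; commuting with
    \<open>e\<close> suffices for \<open>q * c ^ n\<close> to do so.\<close>
  have "e * q = q * e" using qcom cornerD[OF cn] by simp
  then have "f \<in> corner e e"
    unfolding q using cornerD[OF cn] by (auto simp: corner_def mult.assoc) (metis mult.assoc)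
  moreover have "f \<noteq> 0"
  proof
    assume "f = 0"
    \<comment> \<open>As \<open>c ^ n\<close> fixes \<open>a\<close>, \<open>1 - c ^ n\<close> kills
      it, whereas \<open>f = 0\<close> would mean \<open>(1 - c ^ n) ^ n = 1\<close>.\<close>
    have "c ^ k * a = a" for k
      by (induction k) (simp_all add: ca mult.assoc)
    then have "(1 - c ^ n) * a = 0" by (simp add: algebra_simps)
    then have "(1 - c ^ n) ^ n * a = 0"
      using n(2) by (metis Suc_pred mult.assoc mult_zero_right power_Suc2)
    then have "a = 0" using \<open>f = 0\<close> by (simp add: f_def)
    then show False using a_nil[of 1] by simp
  qed
  moreover have "\<exists>r. f = r * x"
  proof -
    obtain l where l: "a = l * x" using \<open>\<exists>r. a = r * x\<close> by blast
    have "f = q * (c ^ (n - 1) * c)"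
      using q power_minus_mult[OF n(2), of c] by simp
    also have "\<dots> = q * c ^ (n - 1) * (e * s * e) * l * x"
      by (simp only: c_def l mult.assoc)
    finally show ?thesis by blast
  qed
  ultimately show thesis using that idem by blast
qed

section \<open>Units of \<open>eRe\<close>, and locality of \<open>eRe\<close> for primitive
  \<open>e\<close>\<close>

definition corner_units :: "'a::ring_1 \<Rightarrow> 'a set"
  where "corner_units e = {x \<in> corner e e. \<exists>y\<in>corner e e. x * y = e \<and> y * x = e}"

lemma corner_units_mult:
  assumes "x \<in> corner_units e" "y \<in> corner_units e"
  shows "x * y \<in> corner_units e"
proof -
  obtain x' y' where *: "x \<in> corner e e" "y \<in> corner e e" "x' \<in> corner e e" "y' \<in> corner e e"
    "x * x' = e" "x' * x = e" "y * y' = e" "y' * y = e"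
    using assms by (auto simp: corner_units_def)
  have "x * y * (y' * x') = x * (y * y') * x'" "y' * x' * (x * y) = y' * (x' * x) * y"
    by (simp_all add: mult.assoc)
  then have "x * y * (y' * x') = e" "y' * x' * (x * y) = e"
    using * by (simp_all add: cornerD)
  then show ?thesis
    unfolding corner_units_def using corner_mult[OF *(1,2)] corner_mult[OF *(4,3)] by blast
qed

text \<open>Inverses are taken blockwise in \<open>eRe\<close> and \<open>(1 - e)R(1 - e)\<close>,
  the second being \<open>h * (1 - e)\<close>. The factor 2 appears because two elements translated
  by \<open>1 - e\<close> will be added.\<close>

lemma corner_units_lift:
  assumes "e * e = e" "x \<in> corner_units e"
    and h: "2 * h = 1" "h * 2 = (1::'a::ring_1)"
  shows "x + 2 * (1 - e) \<in> (ring_units :: 'a set)"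
proof -
  obtain y where *: "x \<in> corner e e" "y \<in> corner e e" "x * y = e" "y * x = e"
    using assms(2) by (auto simp: corner_units_def)
  define g where "g = 1 - e"
  have g: "g * g = g" "x * g = 0" "y * g = 0" "g * x = 0" "g * y = 0"
    using assms(1) * by (simp_all add: g_def algebra_simps cornerD)
  have hc: "h * z = z * h" for z using commute_inverse_two[OF h] .
  have tc: "2 * z = z * 2" for z :: 'a by (simp add: mult_2 mult_2_right)
  have "2 * g * (h * g) = 2 * (g * h) * g" "h * g * (2 * g) = h * (g * 2) * g"
    by (simp_all only: mult.assoc)
  then have "2 * g * (h * g) = 2 * h * (g * g)" "h * g * (2 * g) = h * 2 * (g * g)"
    unfolding hc[of g, symmetric] tc[of g, symmetric] by (simp_all only: mult.assoc)
  moreover have "x * (h * g) = 0" "y * (2 * g) = 0"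
    using g(2,3) unfolding hc[of g] tc[of g] by (simp_all flip: mult.assoc)
  moreover have "2 * g * y = 0" "h * g * x = 0"
    using g(4,5) by (simp_all add: mult.assoc)
  ultimately have "(x + 2 * g) * (y + h * g) = e + g" "(y + h * g) * (x + 2 * g) = e + g"
    using g h * by (simp_all add: distrib_left distrib_right)
  then show ?thesis unfolding ring_units_def g_def by auto
qed

text \<open>The geometric sum \<open>q\<close> inverts \<open>1 - n\<close> in \<open>R\<close> and
  commutes with \<open>e\<close>, so \<open>e * q * e\<close> inverts \<open>e - n\<close> in
  \<open>eRe\<close>.\<close>

lemma corner_units_diff_nilpotent:
  assumes e: "e * e = (e::'a::ring_1)" and n: "n \<in> corner e e" "n ^ k = 0"
  shows "e - n \<in> corner_units e"
proof -
  obtain q where q: "1 - n ^ k = q * (1 - n)"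
    and com: "\<And>y. y * (1 - n) = (1 - n) * y \<Longrightarrow> y * q = q * y"
    using one_minus_power_factor[of "1 - n" k] by auto
  have 1: "q * (1 - n) = 1" "(1 - n) * q = 1"
    using q com[of "1 - n"] n(2) by simp_all
  have eq: "e * q = q * e"
    using com[of e] n(1) by (simp add: algebra_simps cornerD)
  have "e * q * e \<in> corner e e" using corner_sandwich[OF e e] .
  moreover have "e - n \<in> corner e e"
    using n(1) e by (simp add: corner_def algebra_simps)
  moreover have n': "e - n = e * (1 - n)" "e - n = (1 - n) * e"
    using n(1) by (simp_all add: algebra_simps cornerD)
  have "(e - n) * (e * q * e) = e" "e * q * e * (e - n) = e"
  proof -
    have "(e - n) * (e * q * e) = (1 - n) * (e * e) * q * e" by (simp add: n'(2) mult.assoc)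
    also have "\<dots> = (1 - n) * (e * q) * e" by (simp add: e mult.assoc)
    also have "\<dots> = (1 - n) * q * (e * e)" by (simp add: eq mult.assoc)
    finally show "(e - n) * (e * q * e) = e" using e 1 by simp
    have "e * q * e * (e - n) = e * q * (e * e) * (1 - n)" by (simp add: n'(1) mult.assoc)
    also have "\<dots> = e * (e * q) * (1 - n)" by (metis e eq mult.assoc)
    also have "\<dots> = e * e * (q * (1 - n))" by (simp add: mult.assoc)
    finally show "e * q * e * (e - n) = e" using e 1 by simp
  qed
  ultimately show ?thesis by (auto simp: corner_units_def)
qed

text \<open>For non-nilpotent \<open>x\<close>, the nonzero idempotent in \<open>Rx\<close> must be
  \<open>e\<close>, giving a left inverse \<open>y\<close> in \<open>eRe\<close>. Then
  \<open>x * y\<close> is a nonzero idempotent, hence also \<open>e\<close>.\<close>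

lemma primitive_corner_unit_or_nilpotent:
  assumes art: "left_artinian TYPE('a::ring_1)" and e: "(e::'a) * e = e"
    and prim: "\<And>f. f \<in> corner e e \<Longrightarrow> f * f = f \<Longrightarrow> f = 0 \<or> f = e"
    and x: "x \<in> corner e e"
  shows "x \<in> corner_units e \<or> (\<exists>n. x ^ n = 0)"
proof (cases "\<exists>n. x ^ n = 0")
  case False
  then obtain f r where f: "f \<in> corner e e" "f * f = f" "f \<noteq> 0" "f = r * x"
    using idempotent_in_corner_left_ideal[OF art e x] by blast
  then have r: "r * x = e" using prim by blast
  have "e \<noteq> 0" using f prim by blast
  define y where "y = e * r * e"
  have y: "y \<in> corner e e" unfolding y_def using corner_sandwich[OF e e] .
  have "y * x = e * (r * (e * x))" by (simp add: y_def mult.assoc)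
  then have yx: "y * x = e" using r e cornerD[OF x] by simp
  have "x * y * (x * y) = x * (y * x) * y" by (simp add: mult.assoc)
  then have "x * y * (x * y) = x * y" using yx cornerD[OF x] by simp
  moreover have "x * y \<noteq> 0"
  proof
    assume "x * y = 0"
    have "y * x * (y * x) = y * (x * y) * x" by (simp add: mult.assoc)
    then show False using \<open>x * y = 0\<close> yx e \<open>e \<noteq> 0\<close> by simp
  qed
  ultimately have "x * y = e" using prim corner_mult[OF x y] by blast
  then show ?thesis using x y yx by (auto simp: corner_units_def)
qed simp

text \<open>If \<open>v\<close> inverts \<open>x + y\<close>, then \<open>v * x\<close> is a
  non-unit, hence nilpotent. So \<open>e - v * x = v * y\<close> is a unit, and with it
  \<open>y = (x + y) * (v * y)\<close>.\<close>

lemma primitive_corner_nonunits_add: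
  assumes art: "left_artinian TYPE('a::ring_1)" and e: "(e::'a) * e = e"
    and prim: "\<And>f. f \<in> corner e e \<Longrightarrow> f * f = f \<Longrightarrow> f = 0 \<or> f = e"
    and x: "x \<in> corner e e" "x \<notin> corner_units e" and y: "y \<in> corner e e" "y \<notin> corner_units e"
  shows "x + y \<notin> corner_units e"
proof
  assume u: "x + y \<in> corner_units e"
  then obtain v where v: "v \<in> corner e e" "(x + y) * v = e" "v * (x + y) = e"
    by (auto simp: corner_units_def)
  have cancel: "(x + y) * (v * z) = z" if "z \<in> corner e e" for z
    using v(2) cornerD[OF that] by (simp flip: mult.assoc)
  have "v * x \<notin> corner_units e"
    using corner_units_mult[OF u, of "v * x"] cancel[OF x(1)] x(2) by auto
  then obtain n where "(v * x) ^ n = 0"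
    using primitive_corner_unit_or_nilpotent[OF art e prim corner_mult[OF v(1) x(1)]] by blast
  then have "e - v * x \<in> corner_units e"
    by (intro corner_units_diff_nilpotent[OF e corner_mult[OF v(1) x(1)]])
  moreover have "e - v * x = v * y" using v(3) by (simp add: algebra_simps)
  ultimately show False
    using corner_units_mult[OF u, of "v * y"] cancel[OF y(1)] y(2) by auto
qed

section \<open>Finiteness of corners\<close>

lemma finite_primitive_corner:
  assumes art: "left_artinian TYPE('a::ring_1)" and e: "(e::'a) * e = e"
    and two: "(2 :: 'a) \<in> ring_units"
    and cl: "clique_number (unit_graph :: 'a sgraph) < \<infinity>"
    and prim: "\<And>f. f \<in> corner e e \<Longrightarrow> f * f = f \<Longrightarrow> f = 0 \<or> f = e"
  shows "finite (corner e e)"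
proof (rule ccontr)
  assume inf: "infinite (corner e e)"
  obtain h :: 'a where h: "2 * h = 1" "h * 2 = 1"
    using two by (auto simp: ring_units_def)
  have lift: "(x + (1 - e)) + (y + (1 - e)) \<in> ring_units" if "x + y \<in> corner_units e" for x y
  proof -
    have "(x + (1 - e)) + (y + (1 - e)) = (x + y) + 2 * (1 - e)"
      by (simp only: mult_2 ac_simps)
    then show ?thesis using corner_units_lift[OF e that h] by (simp only:)
  qed
  define N where "N = corner e e - corner_units e"
  have e_in: "e \<in> corner e e" using e by (simp add: corner_def)
  have minus: "- z \<in> N" if "z \<in> N" for z
  proof -
    have "- z \<notin> corner_units e"
    proof
      assume "- z \<in> corner_units e"
      moreover have "- e \<in> corner_units e"
        unfolding corner_units_def using e by (auto simp: corner_def intro!: exI[of _ "- e"])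
      ultimately have "- e * - z \<in> corner_units e" by (rule corner_units_mult[rotated])
      then show False using that cornerD[of z e e] by (simp add: N_def)
    qed
    then show ?thesis using that by (auto simp: N_def corner_def)
  qed
  have two_e: "e + e \<in> corner_units e"
  proof -
    have he: "h * e = e * h" using commute_inverse_two[OF h] .
    have "(e + e) * (h * e) = 2 * (e * h) * e" by (simp add: mult_2 distrib_right mult.assoc)
    also have "\<dots> = 2 * h * (e * e)" by (simp only: he[symmetric] mult.assoc)
    finally have 1: "(e + e) * (h * e) = e" using h e by simp
    have "h * e * (e + e) = h * 2 * (e * e)"
      by (simp add: mult_2 mult_2_right distrib_left distrib_right mult.assoc)
    then have 2: "h * e * (e + e) = e" using h e by simp
    have "h * e \<in> corner e e"
      using corner_sandwich[OF e e, of h] e by (simp add: he[symmetric] mult.assoc)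
    then show ?thesis
      unfolding corner_units_def using 1 2 corner_add[OF e_in e_in] by blast
  qed
  \<comment> \<open>This set is \<open>1 + N\<close>, split so that \<open>lift\<close> applies to
    \<open>e + z\<close>. If \<open>e + z + (e + w)\<close> were a non-unit, subtracting
    \<open>z + w\<close> would make \<open>e + e\<close> a non-unit.\<close>
  have "finite ((\<lambda>z. (e + z) + (1 - e)) ` N)"
  proof (rule finite_if_pairwise_unit_sums[OF cl], clarify, rule lift)
    fix z w assume zw: "z \<in> N" "w \<in> N"
    show "e + z + (e + w) \<in> corner_units e"
    proof (rule ccontr)
      assume *: "e + z + (e + w) \<notin> corner_units e"
      have "- z + - w \<in> N"
        using primitive_corner_nonunits_add[OF art e prim, of "- z" "- w"]
          corner_add[of "- z" e e "- w"] minus[OF zw(1)] minus[OF zw(2)] unfolding N_def by blast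
      moreover have "e + z + (e + w) \<in> corner e e"
        using zw e_in by (auto simp: N_def intro: corner_add)
      ultimately have "(e + z + (e + w)) + (- z + - w) \<notin> corner_units e"
        using * primitive_corner_nonunits_add[OF art e prim, of "e + z + (e + w)" "- z + - w"]
        unfolding N_def by blast
      then show False using two_e by (simp add: algebra_simps)
    qed
  qed
  then have finN: "finite N"
    by (rule finite_imageD) (auto simp: inj_on_def)
  obtain k where k: "\<And>C :: 'a set. finite C \<Longrightarrow>
    (\<And>a b. a \<in> C \<Longrightarrow> b \<in> C \<Longrightarrow> a \<noteq> b \<Longrightarrow> a + b \<in> ring_units) \<Longrightarrow> card C \<le> k"
    using bounded_cliques_if_clique_number_finite[OF cl] by blast
  have "\<exists>C. finite C \<and> card C = m \<and> C \<subseteq> corner e e \<and>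
    (\<forall>a\<in>C. \<forall>b\<in>C. a \<noteq> b \<longrightarrow> a + b \<in> corner_units e)" for m
  proof (induction m)
    case 0
    show ?case by (intro exI[of _ "{}"]) simp
  next
    case (Suc m)
    then obtain C where C: "finite C" "card C = m" "C \<subseteq> corner e e"
      "\<And>a b. a \<in> C \<Longrightarrow> b \<in> C \<Longrightarrow> a \<noteq> b \<Longrightarrow> a + b \<in> corner_units e" by blast
    \<comment> \<open>Greedy step: \<open>x + a\<close> lies in \<open>N\<close> exactly when
      \<open>x = z - a\<close> for some \<open>z\<close> in \<open>N\<close>, so only finitely many
      \<open>x\<close> are excluded.\<close>
    have "finite (C \<union> (\<lambda>(z, a). z - a) ` (N \<times> C))" using C finN by blast
    then obtain x where x: "x \<in> corner e e" "x \<notin> C" "x \<notin> (\<lambda>(z, a). z - a) ` (N \<times> C)"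
      using inf by (metis UnI1 UnI2 finite_subset subsetI)
    have "x + a \<in> corner_units e" if "a \<in> C" for a
    proof (rule ccontr)
      assume "x + a \<notin> corner_units e"
      then have "x + a \<in> N" using x C that by (auto simp: N_def intro: corner_add)
      then have "x \<in> (\<lambda>(z, a). z - a) ` (N \<times> C)"
        using that by (intro image_eqI[of _ _ "(x + a, a)"]) auto
      then show False using x by simp
    qed
    then show ?case using C x by (intro exI[of _ "insert x C"]) (auto simp: add.commute)
  qed
  then obtain C where C: "finite C" "card C = Suc k"
    "\<And>a b. a \<in> C \<Longrightarrow> b \<in> C \<Longrightarrow> a \<noteq> b \<Longrightarrow> a + b \<in> corner_units e" by metis
  have "card ((\<lambda>x. x + (1 - e)) ` C) \<le> k"
    using C lift by (intro k) auto
  moreover have "card ((\<lambda>x. x + (1 - e)) ` C) = card C"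
    by (intro card_image) (simp add: inj_on_def)
  ultimately show False using C by simp
qed

text \<open>From \<open>g * f = 0\<close>, any two elements of \<open>fRg\<close> have product zero,
  so each sum \<open>(1 + x) + (1 + y)\<close> is 2 plus a square-zero element.\<close>

lemma finite_orthogonal_corner:
  assumes two: "(2 :: 'a::ring_1) \<in> ring_units"
    and cl: "clique_number (unit_graph :: 'a sgraph) < \<infinity>"
    and "g * f = (0::'a)"
  shows "finite (corner f g)"
proof -
  have zero: "x * y = 0" if "x \<in> corner f g" "y \<in> corner f g" for x y
  proof -
    have "x * y = x * (g * f) * y"
      using that by (metis cornerD mult.assoc)
    then show ?thesis using assms(3) by simp
  qed
  have "finite ((\<lambda>x. 1 + x) ` corner f g)"
  proof (rule finite_if_pairwise_unit_sums[OF cl], clarify)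
    fix x y assume "x \<in> corner f g" "y \<in> corner f g"
    then have "x + y \<in> corner f g" by (rule corner_add)
    then have "2 + (x + y) \<in> ring_units"
      by (intro two_plus_square_zero_unit[OF two] zero)
    moreover have "1 + x + (1 + y) = 2 + (x + y)"
      by (simp only: one_add_one[symmetric] ac_simps)
    ultimately show "1 + x + (1 + y) \<in> ring_units" by (simp only:)
  qed
  then show ?thesis by (rule finite_imageD) simp
qed

text \<open>Peirce decomposition: each element is a sum of four components, and orthogonality makes
  the two off-diagonal corners finite.\<close>

lemma finite_corner_split:
  assumes two: "(2 :: 'a::ring_1) \<in> ring_units"
    and cl: "clique_number (unit_graph :: 'a sgraph) < \<infinity>"
    and idem: "f * f = (f::'a)" "g * g = g" and orth: "f * g = 0" "g * f = 0"
    and fin: "finite (corner f f)" "finite (corner g g)"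
  shows "finite (corner (f + g) (f + g))"
proof (rule finite_subset)
  let ?X = "(corner f f \<times> corner f g) \<times> (corner g f \<times> corner g g)"
  show "finite ((\<lambda>((a, b), (c, d)). a + b + (c + d)) ` ?X)"
    by (intro finite_imageI finite_cartesian_product fin finite_orthogonal_corner[OF two cl] orth)
  show "corner (f + g) (f + g) \<subseteq> (\<lambda>((a, b), (c, d)). a + b + (c + d)) ` ?X"
  proof
    fix x assume "x \<in> corner (f + g) (f + g)"
    then have "x = (f + g) * x * (f + g)" by (simp add: cornerD)
    then have "x = f * x * f + f * x * g + (g * x * f + g * x * g)"
      by (simp add: algebra_simps)
    then show "x \<in> (\<lambda>((a, b), (c, d)). a + b + (c + d)) ` ?X"
      using idem by (intro image_eqI[of _ _ "((f * x * f, f * x * g), (g * x * f, g * x * g))"])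
        (auto intro: corner_sandwich)
  qed
qed

section \<open>Reduction to a primitive idempotent\<close>

theorem theorem2p3:
  assumes "left_artinian TYPE('a::ring_1)"
    and "(2 :: 'a) \<in> ring_units"
    and "clique_number (unit_graph :: 'a sgraph) < \<infinity>"
  shows "finite (UNIV :: 'a set)"
proof (rule ccontr)
  assume inf: "infinite (UNIV :: 'a set)"
  define P where "P e \<longleftrightarrow> e * e = e \<and> infinite (corner e e)" for e :: 'a
  have "P 1" using inf by (simp add: P_def corner_def)
  then obtain e where "P e" and min: "\<And>b. P b \<Longrightarrow> (\<exists>r. b = r * e) \<Longrightarrow> \<exists>r. e = r * b"
    using left_artinian_minimal[OF assms(1), of P] by blast
  then have e: "e * e = e" and inf_e: "infinite (corner e e)" by (auto simp: P_def)
  \<comment> \<open>Minimality of \<open>Re\<close> gives \<open>e = r * f\<close>; hence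
    \<open>e * f = e\<close>, while \<open>e * f = f\<close> in the corner.\<close>
  have P_eq: "f = e" if f: "P f" "f \<in> corner e e" for f
  proof -
    have "f = f * e" using cornerD[OF f(2)] by simp
    then obtain r where "e = r * f" using min[OF f(1)] by blast
    then have "e * f = e" using f(1) by (simp add: P_def mult.assoc)
    then show ?thesis using cornerD[OF f(2)] by simp
  qed
  have "f = 0 \<or> f = e" if f: "f \<in> corner e e" "f * f = f" for f
  proof -
    have g: "(e - f) * (e - f) = e - f" "f * (e - f) = 0" "(e - f) * f = 0" "e - f \<in> corner e e"
      using f e by (simp_all add: corner_def algebra_simps)
    \<comment> \<open>\<open>e\<close> is the sum of the orthogonal idempotents \<open>f\<close> and
      \<open>e - f\<close>; the one with infinite corner equals \<open>e\<close>.\<close>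
    have "infinite (corner f f) \<or> infinite (corner (e - f) (e - f))"
      using finite_corner_split[OF assms(2,3) f(2) g(1-3)] inf_e by auto
    then have "P f \<or> P (e - f)" using f g by (simp add: P_def)
    then have "f = e \<or> e - f = e" using P_eq f(1) g(4) by blast
    then show ?thesis by (auto simp: algebra_simps)
  qed
  then show False
    using finite_primitive_corner[OF assms(1) e assms(2,3)] inf_e by blast
qed

end
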